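(* Let $f:\mathbb{T}\to[0,1]$ be a Borel function with $\sigma:=\int_{\mathbb{T}} f\,d\mathfrak{m}\in(0,1)$, and let $(\xi_n)_{n\in\mathbb{Z}}$ be the $\{0,1\}$-valued random field of the determinantal point process on $\mathbb{Z}$ induced by the kernel $K_f(n,m)=\widehat{f}(n-m)$, defined on a probability space $(\Omega,\mathcal{A},\mathbb{P})$. Let $P\in\mathbb{Z}[x]$ be a polynomial of degree $d\ge 1$ such that $P(\mathbb{N})\subset\mathbb{N}$. For all $N$ large enough, $$\mathbb{P}\left(\max_{0\le t\le 1}\left|\sum_{n=0}^{N-1}(\xi_n(\omega)-\sigma)e^{2\pi i P(n)t}\right|\ge 100\sqrt{dN\log N}\right)\le\frac{1}{N^2}.$$ Therefore, almost surely, there exists $C_\omega>0$ such that for any $N\ge 2$, $$\max_{0\le t\le 1}\left|\sum_{n=0}^{N-1}(\xi_n(\omega)-\sigma)e^{2\pi i P(n)t}\right|\le C_\omega\sqrt{dN\log N}.$$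
   Context: $\mathbb{T}=\mathbb{R}/\mathbb{Z}$ with normalized Lebesgue measure $\mathfrak{m}$; $\widehat{f}(n)=\int_{\mathbb{T}} f(t)e^{-2\pi i n t}\,d\mathfrak{m}(t)$; $\mathbb{N}$ is the set of non-negative integers. The (stationary) determinantal point process induced by $K_f$ is the random subset $\mathfrak{X}=\mathfrak{X}(\omega)$ of $\mathbb{Z}$ whose indicator random variables $\xi_n(\omega)=1$ if $n\in\mathfrak{X}(\omega)$ and $\xi_n(\omega)=0$ otherwise satisfy, for all distinct $n_1,\dots,n_k\in\mathbb{Z}$, $\mathbb{E}(\xi_{n_1}\cdots\xi_{n_k})=\det(\widehat{f}(n_i-n_j))_{1\le i,j\le k}$. Such a process exists and its law is uniquely determined by $f$. *)

theory Defs
  imports "HOL-Probability.Probability" "Jordan_Normal_Form.Determinant"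
begin

(* A function on the circle T = R/Z is a function on the reals with period 1; the normalized
   Lebesgue measure on T is then Lebesgue measure on the fundamental domain {0..<1}. *)

definition circle_fun :: "(real \<Rightarrow> 'a) \<Rightarrow> bool" where
  "circle_fun f \<longleftrightarrow> (\<forall>t. f (t + 1) = f t)"

definition circle_integral :: "(real \<Rightarrow> 'a :: {banach, second_countable_topology}) \<Rightarrow> 'a" where
  "circle_integral f = (LINT t:{0..<1}|lborel. f t)"

definition fourier_coeff :: "(real \<Rightarrow> real) \<Rightarrow> int \<Rightarrow> complex" where
  "fourier_coeff f n =
     circle_integral (\<lambda>t. complex_of_real (f t) * exp (- 2 * pi * \<i> * of_int n * t))"

definition fourier_kernel :: "(real \<Rightarrow> real) \<Rightarrow> int \<Rightarrow> int \<Rightarrow> complex" where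
  "fourier_kernel f n m = fourier_coeff f (n - m)"

definition occupation :: "('w \<Rightarrow> int set) \<Rightarrow> int \<Rightarrow> 'w \<Rightarrow> real" where
  "occupation X n \<omega> = (if n \<in> X \<omega> then 1 else 0)"

(* The list ns enumerates the distinct points n_1, ..., n_k. *)

definition determinantal_point_process ::
    "'w measure \<Rightarrow> (int \<Rightarrow> int \<Rightarrow> complex) \<Rightarrow> ('w \<Rightarrow> int set) \<Rightarrow> bool" where
  "determinantal_point_process M K X \<longleftrightarrow>
     prob_space M \<and>
     (\<forall>n. occupation X n \<in> borel_measurable M) \<and>
     (\<forall>ns. distinct ns \<longrightarrow>
        complex_of_real (LINT \<omega>|M. (\<Prod>n\<leftarrow>ns. occupation X n \<omega>)) =
        Determinant.det (mat (length ns) (length ns) (\<lambda>(i, j). K (ns ! i) (ns ! j))))"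

definition exp_sum :: "(nat \<Rightarrow> real) \<Rightarrow> int poly \<Rightarrow> nat \<Rightarrow> real \<Rightarrow> complex" where
  "exp_sum a P N t =
     (\<Sum>n<N. complex_of_real (a n) * exp (2 * pi * \<i> * of_int (poly P (int n)) * t))"

(* The supremum is a maximum, and it is a random variable when the coefficients are;
   both facts are proved below. *)

definition max_exp_sum :: "(nat \<Rightarrow> real) \<Rightarrow> int poly \<Rightarrow> nat \<Rightarrow> real" where
  "max_exp_sum a P N = (SUP t\<in>{0..1}. cmod (exp_sum a P N t))"

lemma continuous_on_exp_sum: "continuous_on A (\<lambda>t. cmod (exp_sum a P N t))"
  unfolding exp_sum_def by (intro continuous_intros)

lemma max_exp_sum_attained:
  "\<exists>t\<in>{0..1}. max_exp_sum a P N = cmod (exp_sum a P N t) \<and>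
     (\<forall>s\<in>{0..1}. cmod (exp_sum a P N s) \<le> cmod (exp_sum a P N t))"
proof -
  obtain t where t: "t \<in> {0..1}"
      "\<And>s. s \<in> {0..1} \<Longrightarrow> cmod (exp_sum a P N s) \<le> cmod (exp_sum a P N t)"
    using continuous_attains_sup[OF compact_Icc _ continuous_on_exp_sum, of "0::real" 1 a P N]
    by auto
  have "max_exp_sum a P N = cmod (exp_sum a P N t)"
    unfolding max_exp_sum_def by (rule cSup_eq_maximum) (use t in auto)
  with t show ?thesis by blast
qed

lemma max_exp_sum_le_iff:
  "max_exp_sum a P N \<le> c \<longleftrightarrow> (\<forall>t\<in>{0..1}. cmod (exp_sum a P N t) \<le> c)"
  using max_exp_sum_attained[of a P N] by (metis order_trans)

lemma max_exp_sum_measurable: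
  assumes [measurable]: "\<And>n. (\<lambda>\<omega>. a \<omega> n) \<in> borel_measurable M"
  shows "(\<lambda>\<omega>. max_exp_sum (a \<omega>) P N) \<in> borel_measurable M"
proof (rule borel_measurableI_le)
  fix c :: real
  let ?Q = "{0<..<1} \<inter> \<rat> :: real set"
  have cl: "closure ?Q = {0..1}"
    using closure_open_Int_superset[of "{0<..<1::real}" \<rat>] by (simp add: Rats_closure_real)
  have "max_exp_sum b P N \<le> c \<longleftrightarrow> (\<forall>t\<in>?Q. cmod (exp_sum b P N t) \<le> c)" for b
  proof
    assume *: "\<forall>t\<in>?Q. cmod (exp_sum b P N t) \<le> c"
    have "cmod (exp_sum b P N t) \<le> c" if "t \<in> {0..1}" for t
      using continuous_le_on_closure[OF continuous_on_exp_sum, of t ?Q b P N c] that * cl by auto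
    thus "max_exp_sum b P N \<le> c" by (auto simp: max_exp_sum_le_iff)
  qed (auto simp: max_exp_sum_le_iff)
  hence eq: "{\<omega> \<in> space M. max_exp_sum (a \<omega>) P N \<le> c} =
      {\<omega> \<in> space M. \<forall>t\<in>?Q. cmod (exp_sum (a \<omega>) P N t) \<le> c}" by simp
  have [measurable]: "(\<lambda>\<omega>. cmod (exp_sum (a \<omega>) P N t)) \<in> borel_measurable M" for t
    unfolding exp_sum_def by measurable
  have "{\<omega> \<in> space M. cmod (exp_sum (a \<omega>) P N t) \<le> c} \<in> sets M" for t
    by measurable
  moreover have "countable ?Q" by (simp add: countable_rat)
  ultimately show "{\<omega> \<in> space M. max_exp_sum (a \<omega>) P N \<le> c} \<in> sets M"
    unfolding eq by (intro sets.sets_Collect_countable_All')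
qed

end

(* For weights b_n >= 0, expanding the product of the factors 1 + (exp b_n - 1) xi_n and applying
   Hadamard's inequality to the principal minors of the kernel shows that the exponential moment of
   sum b_n xi_n is at most what it would be for independent Bernoulli(sigma) variables. The vacant
   sites behave in the same way: the expectation of prod (1 - xi_n) is a principal minor of I - K,
   the kernel of 1 - f. Splitting real weights into positive and negative parts gives a sub-Gaussian
   bound for every linear statistic, hence for the real and imaginary parts of the exponential sum
   at a fixed t. As P has degree d, the sum has Lipschitz constant at most 2 pi N^(d+2) for large N,
   so a union bound over N^(d+2) + 1 equally spaced points controls the maximum, and the almost sure
   bound follows by Borel-Cantelli. *)

theory Submission
  imports Defs
begin

section \<open>Hadamard's inequality\<close>

text \<open>One step of Gaussian elimination: clearing column 0 below the pivot factors the matrix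
  as \<open>?L * ?U\<close>, with \<open>?L\<close> unit lower triangular and \<open>?U\<close>
  block upper triangular.\<close>

lemma det_Schur_complement:
  fixes A :: "nat \<Rightarrow> nat \<Rightarrow> 'a :: field"
  assumes "A 0 0 \<noteq> 0"
  shows "Determinant.det (mat (Suc k) (Suc k) (\<lambda>(i, j). A i j)) =
    A 0 0 * Determinant.det (mat k k (\<lambda>(i, j). A (Suc i) (Suc j) - A (Suc i) 0 * A 0 (Suc j) / A 0 0))"
    (is "Determinant.det ?A = _ * Determinant.det ?B")
proof -
  define c where "c = mat k 1 (\<lambda>(i, j). A (Suc i) 0 / A 0 0)"
  define r where "r = mat 1 k (\<lambda>(i, j). A 0 (Suc j))"
  define a where "a = mat 1 1 (\<lambda>(i, j). A 0 0)"
  let ?L = "four_block_mat (1\<^sub>m 1) (0\<^sub>m 1 k) c (1\<^sub>m k)"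
  let ?U = "four_block_mat a r (0\<^sub>m k 1) ?B"
  have carr: "c \<in> carrier_mat k 1" "r \<in> carrier_mat 1 k" "a \<in> carrier_mat 1 1" "?B \<in> carrier_mat k k"
    by (simp_all add: c_def r_def a_def)
  have "?L * ?U = four_block_mat (1\<^sub>m 1 * a + 0\<^sub>m 1 k * 0\<^sub>m k 1) (1\<^sub>m 1 * r + 0\<^sub>m 1 k * ?B)
      (c * a + 1\<^sub>m k * 0\<^sub>m k 1) (c * r + 1\<^sub>m k * ?B)"
    by (rule mult_four_block_mat) (use carr in auto)
  also have "\<dots> = ?A"
    by (rule eq_matI) (auto simp: c_def r_def a_def scalar_prod_def assms)
  finally have "?A = ?L * ?U" ..
  hence "Determinant.det ?A = Determinant.det (?L * ?U)" by (rule arg_cong)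
  also have "Determinant.det (?L * ?U) = Determinant.det ?L * Determinant.det ?U"
    by (rule det_mult[of _ "1 + k"]) (use carr in \<open>auto intro!: four_block_carrier_mat\<close>)
  also have "Determinant.det ?L = 1"
    using det_four_block_mat_upper_right_zero[of "1\<^sub>m 1" 1 "0\<^sub>m 1 k" k c "1\<^sub>m k"] carr by simp
  also have "Determinant.det ?U = Determinant.det a * Determinant.det ?B"
    by (rule det_four_block_mat_lower_left_zero) (use carr in auto)
  also have "Determinant.det a = A 0 0"
    by (subst det_single) (simp_all add: a_def)
  finally show ?thesis by simp
qed

lemma det_zero_first_row:
  fixes A :: "nat \<Rightarrow> nat \<Rightarrow> 'a :: comm_ring_1"
  assumes "\<And>j. j < Suc k \<Longrightarrow> A 0 j = 0"
  shows "Determinant.det (mat (Suc k) (Suc k) (\<lambda>(i, j). A i j)) = 0"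
proof -
  have "(\<Prod>i = 0..<Suc k. mat (Suc k) (Suc k) (\<lambda>(i, j). A i j) $$ (i, p i)) = 0"
    if "p permutes {0..<Suc k}" for p
  proof (rule prod_zero)
    show "\<exists>i\<in>{0..<Suc k}. mat (Suc k) (Suc k) (\<lambda>(i, j). A i j) $$ (i, p i) = 0"
      using permutes_in_image[OF that, of 0] assms by (intro bexI[of _ 0]) auto
  qed auto
  thus ?thesis by (subst det_def'[of _ "Suc k"]) (auto simp del: prod.op_ivl_Suc)
qed

text \<open>Entry functions with an explicit size, rather than matrices, let the Schur complement be
  written by shifting indices. Nonnegativity of the real part alone would not force Hermitian
  symmetry, hence the separate clause.\<close>

definition pos_semidef :: "nat \<Rightarrow> (nat \<Rightarrow> nat \<Rightarrow> complex) \<Rightarrow> bool" where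
  "pos_semidef k A \<longleftrightarrow> (\<forall>i<k. \<forall>j<k. A j i = cnj (A i j)) \<and>
     (\<forall>x. 0 \<le> Re (\<Sum>i<k. \<Sum>j<k. cnj (x i) * A i j * x j))"

lemma pos_semidef_cnj:
  "pos_semidef k A \<Longrightarrow> i < k \<Longrightarrow> j < k \<Longrightarrow> cnj (A i j) = A j i"
  unfolding pos_semidef_def by metis

lemma pos_semidef_nonneg:
  "pos_semidef k A \<Longrightarrow> 0 \<le> Re (\<Sum>i<k. \<Sum>j<k. cnj (x i) * A i j * x j)"
  unfolding pos_semidef_def by blast

lemma quadratic_form_unit:
  fixes A :: "nat \<Rightarrow> nat \<Rightarrow> complex"
  assumes "i < k"
  shows "(\<Sum>l<k. \<Sum>j<k. cnj (if l = i then 1 else 0) * A l j * (if j = i then 1 else 0)) = A i i"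
proof -
  have "cnj (if l = i then 1 else 0) * A l j * (if j = i then 1 else 0) =
      (if j = i then if l = i then A l j else 0 else 0)" for l j
    by simp
  thus ?thesis using assms by simp
qed

lemma pos_semidef_diag:
  assumes "pos_semidef k A" "i < k"
  shows "A i i = of_real (Re (A i i))" "0 \<le> Re (A i i)"
proof -
  show "A i i = of_real (Re (A i i))"
    using pos_semidef_cnj[OF assms(1) assms(2) assms(2)] by (simp add: complex_eq_iff)
  have "0 \<le> Re (\<Sum>l<k. \<Sum>j<k. cnj (if l = i then 1 else 0) * A l j * (if j = i then 1 else 0))"
    using assms(1) by (rule pos_semidef_nonneg)
  also have "\<dots> = Re (A i i)" by (simp only: quadratic_form_unit[OF assms(2)])
  finally show "0 \<le> Re (A i i)" .
qed

text \<open>Splits off coordinate 0. By Hermitian symmetry the cross terms of row 0 and column 0 are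
  conjugate, so a single sum \<open>s\<close> describes both.\<close>

lemma quadratic_form_Suc:
  fixes A :: "nat \<Rightarrow> nat \<Rightarrow> complex" and x :: "nat \<Rightarrow> complex"
  assumes psd: "pos_semidef (Suc k) A"
  defines "s \<equiv> \<Sum>j<k. A 0 (Suc j) * x (Suc j)"
  shows "(\<Sum>i<Suc k. \<Sum>j<Suc k. cnj (x i) * A i j * x j) =
    cnj (x 0) * A 0 0 * x 0 + cnj (x 0) * s + cnj s * x 0 +
    (\<Sum>i<k. \<Sum>j<k. cnj (x (Suc i)) * A (Suc i) (Suc j) * x (Suc j))"
proof -
  have "cnj s * x 0 = (\<Sum>i<k. cnj (x (Suc i)) * A (Suc i) 0 * x 0)"
    unfolding s_def cnj_sum sum_distrib_right
    by (intro sum.cong refl) (simp add: pos_semidef_cnj[OF psd] mult_ac)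
  moreover have "cnj (x 0) * s = (\<Sum>j<k. cnj (x 0) * A 0 (Suc j) * x (Suc j))"
    by (simp add: s_def sum_distrib_left mult_ac)
  ultimately show ?thesis
    by (simp add: sum.lessThan_Suc_shift sum.distrib del: sum.lessThan_Suc)
qed

lemma pos_semidef_Schur_complement:
  assumes psd: "pos_semidef (Suc k) A" and nz: "A 0 0 \<noteq> 0"
  shows "pos_semidef k (\<lambda>i j. A (Suc i) (Suc j) - A (Suc i) 0 * A 0 (Suc j) / A 0 0)"
    (is "pos_semidef k ?B")
  unfolding pos_semidef_def
proof (intro conjI allI impI)
  note herm = pos_semidef_cnj[OF psd]
  have a: "cnj (A 0 0) = A 0 0" by (simp add: herm)
  show "?B j i = cnj (?B i j)" if "i < k" "j < k" for i j
    using that by (simp add: herm)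
  fix x
  define s where "s = (\<Sum>j<k. A 0 (Suc j) * x j)"
  \<comment> \<open>For given \<open>x\<close>, the value \<open>y 0 = - s / A 0 0\<close> minimises the quadratic form of \<open>A\<close>.\<close>
  define y where "y i = (case i of 0 \<Rightarrow> - s / A 0 0 | Suc i \<Rightarrow> x i)" for i
  have cs: "cnj s = (\<Sum>i<k. cnj (x i) * A (Suc i) 0)"
    unfolding s_def cnj_sum
    by (intro sum.cong refl) (simp add: herm mult_ac)
  have "0 \<le> Re (\<Sum>i<Suc k. \<Sum>j<Suc k. cnj (y i) * A i j * y j)"
    by (rule pos_semidef_nonneg[OF psd])
  also have "(\<Sum>i<Suc k. \<Sum>j<Suc k. cnj (y i) * A i j * y j) =
      (\<Sum>i<k. \<Sum>j<k. cnj (x i) * A (Suc i) (Suc j) * x j) - cnj s * s / A 0 0"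
  proof -
    have y: "y 0 = - s / A 0 0" "y (Suc i) = x i" for i by (simp_all add: y_def)
    show ?thesis
      unfolding quadratic_form_Suc[OF psd] y s_def[symmetric]
      using nz a by (simp add: field_simps)
  qed
  also have "cnj s * s / A 0 0 = (\<Sum>i<k. \<Sum>j<k. cnj (x i) * (A (Suc i) 0 * A 0 (Suc j) / A 0 0) * x j)"
    unfolding cs unfolding s_def sum_product sum_divide_distrib by (simp add: mult_ac)
  also have "(\<Sum>i<k. \<Sum>j<k. cnj (x i) * A (Suc i) (Suc j) * x j) - \<dots> =
      (\<Sum>i<k. \<Sum>j<k. cnj (x i) * ?B i j * x j)"
    by (simp add: sum_subtractf algebra_simps)
  finally show "0 \<le> Re (\<Sum>i<k. \<Sum>j<k. cnj (x i) * ?B i j * x j)" .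
qed

text \<open>With a zero diagonal entry the form is affine along a line of test vectors, so a nonzero
  entry in that row would make it negative somewhere.\<close>

lemma pos_semidef_zero_diag:
  assumes psd: "pos_semidef (Suc k) A" and z: "A 0 0 = 0" and j: "j < Suc k"
  shows "A 0 j = 0"
proof (cases j)
  case (Suc l)
  hence l: "l < k" using j by simp
  define b where "b = A 0 (Suc l)"
  define c where "c = Re (A (Suc l) (Suc l))"
  have *: "0 \<le> c - 2 * r * (cmod b)\<^sup>2" for r :: real
  proof -
    \<comment> \<open>The phase of coordinate 0 is chosen so that both cross terms equal -r
      |b|^2.\<close>
    define y where "y i = (case i of 0 \<Rightarrow> - of_real r * b | Suc i \<Rightarrow> if i = l then 1 else 0)" for i
    have "0 \<le> Re (\<Sum>i<Suc k. \<Sum>j<Suc k. cnj (y i) * A i j * y j)"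
      by (rule pos_semidef_nonneg[OF psd])
    also have "(\<Sum>i<Suc k. \<Sum>j<Suc k. cnj (y i) * A i j * y j) =
        A (Suc l) (Suc l) - 2 * of_real r * (b * cnj b)"
    proof -
      have y: "y 0 = - of_real r * b" "y (Suc i) = (if i = l then 1 else 0)" for i
        by (simp_all add: y_def)
      have "(\<Sum>j<k. A 0 (Suc j) * (if j = l then 1 else 0)) = (\<Sum>j<k. if j = l then A 0 (Suc j) else 0)"
        by (intro sum.cong) auto
      also have "\<dots> = b" using l by (simp add: b_def)
      finally have s: "(\<Sum>j<k. A 0 (Suc j) * (if j = l then 1 else 0)) = b" .
      note quadratic_form_unit[OF l, of "\<lambda>i j. A (Suc i) (Suc j)"]
      with s show ?thesis
        unfolding quadratic_form_Suc[OF psd] y z by (simp add: algebra_simps)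
    qed
    finally show ?thesis by (simp add: c_def complex_norm_square[symmetric] flip: of_real_power)
  qed
  have "(cmod b)\<^sup>2 = 0"
  proof (rule ccontr)
    assume "(cmod b)\<^sup>2 \<noteq> 0"
    \<comment> \<open>This value of \<open>r\<close> makes the right-hand side of \<open>*\<close>
      equal to -1.\<close>
    with *[of "(c + 1) / (2 * (cmod b)\<^sup>2)"] show False by (simp add: field_simps)
  qed
  thus ?thesis by (simp add: b_def Suc)
qed (use z in simp)

text \<open>Induction by elimination of index 0: the determinant is the pivot times that of the
  Schur complement, whose diagonal entries do not exceed those of \<open>A\<close>.\<close>

theorem Hadamard_inequality:
  "pos_semidef k A \<Longrightarrow> Re (Determinant.det (mat k k (\<lambda>(i, j). A i j))) \<le> (\<Prod>i<k. Re (A i i))"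
proof (induction k arbitrary: A)
  case (Suc k)
  show ?case
  proof (cases "A 0 0 = 0")
    case True
    thus ?thesis
      using pos_semidef_zero_diag[OF Suc.prems] pos_semidef_diag[OF Suc.prems]
      by (subst det_zero_first_row) (auto intro!: prod_nonneg simp del: prod.lessThan_Suc)
  next
    case False
    define B where "B i j = A (Suc i) (Suc j) - A (Suc i) 0 * A 0 (Suc j) / A 0 0" for i j
    define a where "a = Re (A 0 0)"
    have a: "A 0 0 = of_real a" "0 \<le> a"
      using pos_semidef_diag[OF Suc.prems, of 0] by (auto simp: a_def)
    have B: "pos_semidef k B"
      unfolding B_def by (rule pos_semidef_Schur_complement[OF Suc.prems False])
    have le: "Re (B i i) \<le> Re (A (Suc i) (Suc i))" if "i < k" for i
    proof -
      have "A (Suc i) 0 = cnj (A 0 (Suc i))"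
        using that by (simp add: pos_semidef_cnj[OF Suc.prems])
      \<comment> \<open>Row and column 0 are conjugate, so the subtracted diagonal term is a squared
        modulus over a positive pivot.\<close>
      hence "A (Suc i) 0 * A 0 (Suc i) / A 0 0 = of_real ((cmod (A 0 (Suc i)))\<^sup>2 / a)"
        by (simp only: a complex_norm_square of_real_divide mult.commute)
      thus ?thesis using a by (simp add: B_def del: of_real_divide)
    qed
    have "Re (Determinant.det (mat (Suc k) (Suc k) (\<lambda>(i, j). A i j))) =
        a * Re (Determinant.det (mat k k (\<lambda>(i, j). B i j)))"
      unfolding B_def by (subst det_Schur_complement[where A = A, OF False]) (simp add: a)
    also have "\<dots> \<le> a * (\<Prod>i<k. Re (B i i))"
      using a by (intro mult_left_mono Suc.IH B)
    also have "\<dots> \<le> a * (\<Prod>i<k. Re (A (Suc i) (Suc i)))"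
      using a le pos_semidef_diag[OF B] by (intro mult_left_mono prod_mono) auto
    also have "\<dots> = (\<Prod>i<Suc k. Re (A i i))"
      by (simp add: prod.lessThan_Suc_shift a_def del: prod.lessThan_Suc)
    finally show ?thesis .
  qed
qed simp

section \<open>Principal minors\<close>

text \<open>The Leibniz formula over an arbitrary finite index set: the minor of \<open>K\<close> on the points of
  \<open>S\<close> needs no enumeration of \<open>S\<close>, and a permutation of \<open>S\<close> fixing \<open>S - T\<close> is one of \<open>T\<close>.\<close>

definition perm_det :: "'a set \<Rightarrow> ('a \<Rightarrow> 'a \<Rightarrow> 'b) \<Rightarrow> 'b :: comm_ring_1" where
  "perm_det S A = (\<Sum>p | p permutes S. of_int (sign p) * (\<Prod>i\<in>S. A i (p i)))"

text \<open>Connects the enumerated minors in \<open>determinantal_point_process\<close> with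
  \<open>perm_det\<close>: conjugating a permutation by the enumeration preserves its sign and only
  relabels the product.\<close>

lemma det_mat_nth:
  assumes "distinct ns"
  shows "Determinant.det (mat (length ns) (length ns) (\<lambda>(i, j). A (ns ! i) (ns ! j))) =
    perm_det (set ns) A"
proof -
  let ?I = "{0..<length ns}"
  let ?e = "(!) ns"
  have e: "bij_betw ?e ?I (set ns)"
    using bij_betw_nth[OF assms, of ?I "set ns"] by (simp add: atLeast0LessThan)
  hence inj: "inj_on ?e ?I" by (rule bij_betw_imp_inj_on)
  have "perm_det (set ns) A =
      (\<Sum>p | p permutes ?I. of_int (sign p) * (\<Prod>i = 0..<length ns. A (ns ! i) (ns ! p i)))"
    unfolding perm_det_def
  proof (rule sum.reindex_bij_witness[where
        j = "map_permutation (set ns) (inv_into ?I ?e)" and i = "map_permutation ?I ?e"], goal_cases)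
    case (1 p)
    hence p: "p permutes set ns" by simp
    show ?case
      using map_permutation_compose_inv[OF bij_betw_inv_into[OF e] p] bij_betw_inv_into_right[OF e]
      by blast
  next
    case (2 p)
    hence p: "p permutes set ns" by simp
    show ?case using map_permutation_permutes[OF bij_betw_inv_into[OF e] p] by simp
  next
    case (3 p)
    hence p: "p permutes ?I" by simp
    show ?case
      by (rule map_permutation_compose_inv[OF e p]) (use inj in auto)
  next
    case (4 p)
    hence p: "p permutes ?I" by simp
    show ?case using map_permutation_permutes[OF e p] by simp
  next
    case (5 p)
    hence p: "p permutes set ns" by simp
    \<comment> \<open>\<open>q\<close> is \<open>p\<close> read on list positions instead of list
      entries.\<close>
    define q where "q = map_permutation (set ns) (inv_into ?I ?e) p"
    have inv: "inj_on (inv_into ?I ?e) (set ns)"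
      using bij_betw_inv_into[OF e] by (rule bij_betw_imp_inj_on)
    have q: "ns ! q i = p (ns ! i)" if "i \<in> ?I" for i
    proof -
      have "q (inv_into ?I ?e (ns ! i)) = inv_into ?I ?e (p (ns ! i))"
        unfolding q_def by (rule map_permutation_apply[OF inv]) (use that in auto)
      moreover have "ns ! i \<in> set ns" using that by simp
      hence "p (ns ! i) \<in> set ns" using permutes_in_image[OF p] by blast
      ultimately show ?thesis
        using that inj bij_betw_inv_into_right[OF e] by (simp add: inv_into_f_f)
    qed
    have "(\<Prod>i\<in>?I. A (ns ! i) (ns ! q i)) = (\<Prod>i\<in>?I. A (ns ! i) (p (ns ! i)))"
      by (intro prod.cong refl) (simp add: q)
    also have "\<dots> = (\<Prod>i\<in>set ns. A i (p i))"
      by (rule prod.reindex_bij_betw[OF e])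
    finally show ?case
      using sign_map_permutation[OF inv p] by (simp add: q_def)
  qed
  moreover have "(\<Prod>i = 0..<length ns. mat (length ns) (length ns) (\<lambda>(i, j). A (ns ! i) (ns ! j)) $$ (i, p i)) =
      (\<Prod>i = 0..<length ns. A (ns ! i) (ns ! p i))" if "p permutes ?I" for p
    using permutes_in_image[OF that] by (intro prod.cong) auto
  ultimately show ?thesis by (subst det_def'[of _ "length ns"]) (auto intro!: sum.cong)
qed

text \<open>In the Leibniz products each site picks either \<open>- A\<close> or the identity, and
  \<open>T\<close> collects the former. The result has the shape of inclusion-exclusion for vacant
  sites.\<close>

lemma perm_det_one_minus:
  assumes "finite S"
  shows "perm_det S (\<lambda>i j. of_bool (i = j) - A i j) = (\<Sum>T\<in>Pow S. (-1) ^ card T * perm_det T A)"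
proof -
  have "perm_det S (\<lambda>i j. of_bool (i = j) - A i j) =
      (\<Sum>p | p permutes S. \<Sum>T\<in>Pow S. of_int (sign p) *
         ((\<Prod>i\<in>T. - A i (p i)) * (\<Prod>i\<in>S - T. of_bool (i = p i))))"
    unfolding perm_det_def
    by (subst sum_distrib_left[symmetric], subst prod_add[symmetric])
      (use assms in \<open>auto simp: algebra_simps\<close>)
  also have "\<dots> = (\<Sum>T\<in>Pow S. \<Sum>p | p permutes S. of_int (sign p) *
         ((\<Prod>i\<in>T. - A i (p i)) * (\<Prod>i\<in>S - T. of_bool (i = p i))))"
    by (rule sum.swap)
  also have "\<dots> = (\<Sum>T\<in>Pow S. \<Sum>p | p permutes T. of_int (sign p) * ((-1) ^ card T * (\<Prod>i\<in>T. A i (p i))))"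
  proof (rule sum.cong[OF refl], rule sum.mono_neutral_cong_right, goal_cases)
    case (1 T) thus ?case using assms by (simp add: finite_permutations)
  next
    case (2 T) thus ?case using permutes_subset by auto
  next
    case (3 T)
    \<comment> \<open>A permutation of \<open>S\<close> that is not one of \<open>T\<close> moves
      some point of \<open>S - T\<close>, where the identity factor vanishes.\<close>
    have "(\<Prod>i\<in>S - T. of_bool (i = p i)) = (0 :: 'b)" if p: "p permutes S" "\<not> p permutes T" for p
    proof -
      obtain i where "i \<in> S - T" "p i \<noteq> i"
        using permutes_superset[OF p(1), of T] p(2) by auto
      thus ?thesis using assms by (intro prod_zero) (auto intro!: bexI[of _ i])
    qed
    thus ?case by auto
  next
    case (4 T p)
    hence "(\<Prod>i\<in>S - T. of_bool (i = p i)) = (1 :: 'b)"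
      by (intro prod.neutral) (auto simp: permutes_not_in)
    thus ?case by (simp add: prod_uminus)
  qed
  also have "\<dots> = (\<Sum>T\<in>Pow S. (-1) ^ card T * perm_det T A)"
    by (simp add: perm_det_def sum_distrib_left mult_ac)
  finally show ?thesis .
qed

section \<open>Fourier kernels\<close>

text \<open>Integration against a probability measure replaces the set integral, so that bounded
  measurable functions are integrable at once.\<close>

lemma circle_integral_altdef:
  "circle_integral g = integral\<^sup>L (restrict_space lborel {0..<1}) g"
  by (simp add: circle_integral_def set_lebesgue_integral_def integral_restrict_space)

lemma prob_space_circle: "prob_space (restrict_space lborel {0..<1::real})"
  by (rule prob_space_restrict_space) auto

lemma integrable_circle:
  fixes g :: "real \<Rightarrow> 'a :: {banach, second_countable_topology}"
  assumes "g \<in> borel_measurable borel" "\<And>t. norm (g t) \<le> B"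
  shows "integrable (restrict_space lborel {0..<1}) g"
proof -
  interpret prob_space "restrict_space lborel {0..<1::real}" by (rule prob_space_circle)
  show ?thesis
    using assms by (intro integrable_const_bound[of _ B] measurable_restrict_space1) auto
qed

lemma fourier_coeff_altdef:
  "fourier_coeff g n =
    integral\<^sup>L (restrict_space lborel {0..<1}) (\<lambda>t. of_real (g t) * cis (- 2 * pi * of_int n * t))"
  unfolding fourier_coeff_def circle_integral_altdef cis_conv_exp by (simp add: mult_ac)

lemma borel_measurable_cis [measurable]: "cis \<in> borel_measurable borel"
  by (intro borel_measurable_continuous_onI continuous_intros)

lemma integrable_fourier:
  assumes [measurable]: "g \<in> borel_measurable borel" and g: "\<And>t. g t \<in> {0..1}"
  shows "integrable (restrict_space lborel {0..<1}) (\<lambda>t. complex_of_real (g t) * cis (a * t))"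
proof (rule integrable_circle[where B = 1])
  show "norm (complex_of_real (g t) * cis (a * t)) \<le> 1" for t
    using g[of t] by (simp add: norm_mult)
qed measurable

lemma fourier_coeff_uminus: "fourier_coeff g (- n) = cnj (fourier_coeff g n)"
  unfolding fourier_coeff_altdef
  by (subst Bochner_Integration.integral_cnj[symmetric]) (simp add: cis_cnj)

lemma fourier_coeff_0: "fourier_coeff g 0 = of_real (circle_integral g)"
  by (simp add: fourier_coeff_altdef circle_integral_altdef)

text \<open>The constant function 1 thus induces the identity kernel. For nonzero \<open>n\<close>,
  the primitive \<open>F\<close> of the character takes equal values at 0 and 1.\<close>

lemma fourier_coeff_one: "fourier_coeff (\<lambda>_. 1) n = of_bool (n = 0)"
proof (cases "n = 0")
  case True
  interpret prob_space "restrict_space lborel {0..<1::real}" by (rule prob_space_circle)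
  show ?thesis using True prob_space by (simp add: fourier_coeff_altdef)
next
  case False
  define a where "a = - 2 * pi * real_of_int n"
  have a: "a \<noteq> 0" using False by (simp add: a_def)
  define F where "F t = cis (a * t) / (\<i> * a)" for t :: real
  have "fourier_coeff (\<lambda>_. 1) n = (\<integral>t. indicator {0..<1} t *\<^sub>R cis (a * t) \<partial>lborel)"
    by (simp add: fourier_coeff_altdef integral_restrict_space a_def)
  \<comment> \<open>The fundamental theorem of calculus is applied on the closed interval; the added
    endpoint is a null set.\<close>
  also have "\<dots> = (\<integral>t. indicator {0..1} t *\<^sub>R cis (a * t) \<partial>lborel)"
  proof (rule integral_cong_AE)
    show "AE t in lborel. indicator {0..<1} t *\<^sub>R cis (a * t) = indicator {0..1} t *\<^sub>R cis (a * t)"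
      using AE_lborel_singleton[of "1::real"] by eventually_elim (auto simp: indicator_def)
  qed measurable
  also have "\<dots> = F 1 - F 0"
  proof (rule integral_FTC_Icc)
    show "(F has_vector_derivative cis (a * t)) (at t within {0..1})" for t
    proof -
      \<comment> \<open>The primitive is differentiated over the complex numbers and then restricted
        to the real line.\<close>
      have "((\<lambda>z. exp (\<i> * of_real a * z) / (\<i> * of_real a)) has_field_derivative
          exp (\<i> * of_real a * of_real t)) (at (of_real t))"
        using a by (auto intro!: derivative_eq_intros)
      from has_vector_derivative_real_field[OF this] show ?thesis
        by (simp add: F_def[abs_def] cis_conv_exp mult_ac)
    qed
  qed (auto intro!: continuous_intros)
  also have "\<dots> = 0"
  proof -
    have "cis a = 1"
      using cis_multiple_2pi[of "of_int (- n)"] by (simp add: a_def mult_ac)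
    thus ?thesis by (simp add: F_def)
  qed
  finally show ?thesis using False by simp
qed

text \<open>Makes I - K the Fourier kernel of 1 - g, so that bounds for occupied sites carry over to
  vacant ones.\<close>

lemma fourier_coeff_one_minus:
  assumes "g \<in> borel_measurable borel" "\<And>t. g t \<in> {0..1}"
  shows "fourier_coeff (\<lambda>t. 1 - g t) n = of_bool (n = 0) - fourier_coeff g n"
proof -
  have "fourier_coeff (\<lambda>t. 1 - g t) n = fourier_coeff (\<lambda>_. 1) n - fourier_coeff g n"
    using Bochner_Integration.integral_diff[OF integrable_fourier[of "\<lambda>_. 1" "- 2 * pi * of_int n"]
        integrable_fourier[OF assms, of "- 2 * pi * of_int n"]]
    by (simp add: fourier_coeff_altdef left_diff_distrib)
  thus ?thesis by (simp add: fourier_coeff_one)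
qed

lemma circle_integral_one_minus:
  fixes g :: "real \<Rightarrow> real"
  assumes [measurable]: "g \<in> borel_measurable borel" and g: "\<And>t. g t \<in> {0..1}"
  shows "circle_integral (\<lambda>t. 1 - g t) = 1 - circle_integral g"
proof -
  interpret prob_space "restrict_space lborel {0..<1::real}" by (rule prob_space_circle)
  have "integrable (restrict_space lborel {0..<1}) g"
  proof (rule integrable_circle[where B = 1])
    show "norm (g t) \<le> 1" for t using g[of t] by simp
  qed simp
  thus ?thesis using prob_space by (simp add: circle_integral_altdef)
qed

text \<open>The quadratic form of the kernel is the integral of g |c|^2, where \<open>c\<close> is
  the trigonometric polynomial with coefficients \<open>x\<close> and frequencies
  \<open>m\<close>.\<close>

lemma pos_semidef_fourier_kernel:
  assumes g: "g \<in> borel_measurable borel" "\<And>t. g t \<in> {0..1}"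
  shows "pos_semidef k (\<lambda>i j. fourier_kernel g (m i) (m j))"
  unfolding pos_semidef_def
proof (intro conjI allI impI)
  show "fourier_kernel g (m j) (m i) = cnj (fourier_kernel g (m i) (m j))" for i j
    using fourier_coeff_uminus[of g "m i - m j"] by (simp add: fourier_kernel_def)
  fix x :: "nat \<Rightarrow> complex"
  define c where "c t = (\<Sum>j<k. x j * cis (2 * pi * of_int (m j) * t))" for t
  have *: "(\<Sum>i<k. \<Sum>j<k. cnj (x i) * x j * (of_real (g t) * cis (- 2 * pi * of_int (m i - m j) * t))) =
      of_real (g t * (cmod (c t))\<^sup>2)" for t
  proof -
    have "of_real (g t * (cmod (c t))\<^sup>2) = of_real (g t) * (cnj (c t) * c t)"
      by (simp only: of_real_mult complex_norm_square mult.commute)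
    also have "\<dots> = (\<Sum>i<k. \<Sum>j<k. of_real (g t) *
        ((cnj (x i) * cis (- (2 * pi * of_int (m i) * t))) * (x j * cis (2 * pi * of_int (m j) * t))))"
      unfolding c_def cnj_sum sum_product by (simp add: sum_distrib_left cis_cnj)
    also have "\<dots> = (\<Sum>i<k. \<Sum>j<k. cnj (x i) * x j * (of_real (g t) *
        (cis (- (2 * pi * of_int (m i) * t)) * cis (2 * pi * of_int (m j) * t))))"
      by (simp add: mult_ac)
    also have "\<dots> = (\<Sum>i<k. \<Sum>j<k. cnj (x i) * x j *
        (of_real (g t) * cis (- 2 * pi * of_int (m i - m j) * t)))"
      by (simp add: cis_mult algebra_simps)
    finally show ?thesis ..
  qed
  have "(\<Sum>i<k. \<Sum>j<k. cnj (x i) * fourier_kernel g (m i) (m j) * x j) =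
      (\<Sum>i<k. \<Sum>j<k. cnj (x i) * x j * fourier_kernel g (m i) (m j))"
    by (simp add: mult_ac)
  also have "\<dots> = integral\<^sup>L (restrict_space lborel {0..<1}) (\<lambda>t.
      \<Sum>i<k. \<Sum>j<k. cnj (x i) * x j * (of_real (g t) * cis (- 2 * pi * of_int (m i - m j) * t)))"
  proof -
    have "integrable (restrict_space lborel {0..<1}) (\<lambda>t. of_real (g t) * cis (- 2 * pi * of_int n * t))" for n
      using integrable_fourier[OF g, of "- 2 * pi * of_int n"] by simp
    thus ?thesis
      unfolding fourier_kernel_def fourier_coeff_altdef
      by (simp add: Bochner_Integration.integral_sum del: of_int_diff)
  qed
  also have "\<dots> = of_real (integral\<^sup>L (restrict_space lborel {0..<1}) (\<lambda>t. g t * (cmod (c t))\<^sup>2))"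
    unfolding * by (rule integral_complex_of_real)
  finally show "0 \<le> Re (\<Sum>i<k. \<Sum>j<k. cnj (x i) * fourier_kernel g (m i) (m j) * x j)"
    using g(2) by (simp add: integral_nonneg)
qed

text \<open>Every diagonal entry of the kernel is the zeroth Fourier coefficient, so Hadamard's
  bound becomes a power of the mean.\<close>

lemma perm_det_fourier_kernel_le:
  assumes g: "g \<in> borel_measurable borel" "\<And>t. g t \<in> {0..1}" and S: "finite S"
  shows "Re (perm_det S (fourier_kernel g)) \<le> circle_integral g ^ card S"
proof -
  obtain ns where ns: "set ns = S" "distinct ns" using finite_distinct_list[OF S] by blast
  have "Re (perm_det S (fourier_kernel g)) =
      Re (Determinant.det (mat (length ns) (length ns) (\<lambda>(i, j). fourier_kernel g (ns ! i) (ns ! j))))"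
    by (simp add: det_mat_nth[OF ns(2)] ns(1))
  also have "\<dots> \<le> (\<Prod>i<length ns. Re (fourier_kernel g (ns ! i) (ns ! i)))"
    by (rule Hadamard_inequality[OF pos_semidef_fourier_kernel[OF g]])
  also have "\<dots> = circle_integral g ^ card S"
    using distinct_card[OF ns(2)] by (simp add: fourier_kernel_def fourier_coeff_0 ns(1))
  finally show ?thesis .
qed

section \<open>Occupied and vacant sites of a determinantal process\<close>

lemma determinantal_occupied:
  assumes "determinantal_point_process M K X" "finite S"
  shows "complex_of_real (LINT \<omega>|M. (\<Prod>n\<in>S. occupation X n \<omega>)) = perm_det S K"
proof -
  obtain ns where ns: "set ns = S" "distinct ns" using finite_distinct_list[OF assms(2)] by blast
  have "(\<Prod>n\<in>S. occupation X n \<omega>) = (\<Prod>n\<leftarrow>ns. occupation X n \<omega>)" for \<omega>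
    unfolding ns(1)[symmetric] by (rule prod.distinct_set_conv_list[OF ns(2)])
  thus ?thesis
    using assms(1) ns det_mat_nth[OF ns(2), of K] by (simp add: determinantal_point_process_def)
qed

text \<open>Both sides are the same alternating sum over subsets: the left by multiplying out the
  product, the right by \<open>perm_det_one_minus\<close>.\<close>

lemma determinantal_vacant:
  assumes dpp: "determinantal_point_process M K X" and S: "finite S"
  shows "complex_of_real (LINT \<omega>|M. (\<Prod>n\<in>S. 1 - occupation X n \<omega>)) =
    perm_det S (\<lambda>i j. of_bool (i = j) - K i j)"
proof -
  interpret prob_space M using dpp by (simp add: determinantal_point_process_def)
  have [measurable]: "occupation X n \<in> borel_measurable M" for n
    using dpp by (simp add: determinantal_point_process_def)
  have int: "integrable M (\<lambda>\<omega>. \<Prod>n\<in>T. occupation X n \<omega>)" for T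
  proof (rule integrable_const_bound[of _ 1])
    have "\<bar>occupation X n \<omega>\<bar> \<le> 1" for n \<omega> by (simp add: occupation_def)
    thus "AE \<omega> in M. norm (\<Prod>n\<in>T. occupation X n \<omega>) \<le> 1"
      by (intro AE_I2) (simp add: abs_prod prod_le_1)
  qed measurable
  have "(\<Prod>n\<in>S. 1 - occupation X n \<omega>) = (\<Sum>T\<in>Pow S. (-1) ^ card T * (\<Prod>n\<in>T. occupation X n \<omega>))" for \<omega>
    using prod_add[OF S, of "\<lambda>n. - occupation X n \<omega>" "\<lambda>_. 1"] by (simp add: prod_uminus)
  hence "(LINT \<omega>|M. (\<Prod>n\<in>S. 1 - occupation X n \<omega>)) =
      (\<Sum>T\<in>Pow S. (-1) ^ card T * (LINT \<omega>|M. (\<Prod>n\<in>T. occupation X n \<omega>)))"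
    using int by (simp add: Bochner_Integration.integral_sum)
  also have "complex_of_real \<dots> = (\<Sum>T\<in>Pow S. (-1) ^ card T * perm_det T K)"
    using determinantal_occupied[OF dpp] finite_subset[OF _ S] by simp
  finally show ?thesis by (simp add: perm_det_one_minus[OF S])
qed

section \<open>Concentration\<close>

context prob_space begin

text \<open>As each \<open>Z\<close> is 0 or 1, exp (b Z) = 1 + c Z, with c >= 0 since b >= 0. Hence
  the moment bounds can be inserted term by term; the sum refolds into a product of Bernoulli(p)
  moment generating functions, and Hoeffding's lemma bounds each factor.\<close>

lemma centered_exp_moment_le:
  fixes Z :: "'i \<Rightarrow> 'a \<Rightarrow> real"
  assumes I: "finite I" and p: "0 \<le> p" "p \<le> 1"
    and Z: "\<And>i. i \<in> I \<Longrightarrow> random_variable borel (Z i)" "\<And>i \<omega>. Z i \<omega> \<in> {0, 1}"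
    and dom: "\<And>T. T \<subseteq> I \<Longrightarrow> expectation (\<lambda>\<omega>. \<Prod>i\<in>T. Z i \<omega>) \<le> p ^ card T"
    and b: "\<And>i. i \<in> I \<Longrightarrow> 0 \<le> b i"
  shows "expectation (\<lambda>\<omega>. exp (\<Sum>i\<in>I. b i * (Z i \<omega> - p))) \<le> exp ((\<Sum>i\<in>I. (b i)\<^sup>2) / 8)"
proof -
  define c where "c i = exp (b i) - 1" for i
  have c: "0 \<le> c i" if "i \<in> I" for i using b[OF that] by (simp add: c_def)
  have int: "integrable M (\<lambda>\<omega>. \<Prod>i\<in>T. Z i \<omega>)" if "T \<subseteq> I" for T
  proof (rule integrable_const_bound)
    show "AE \<omega> in M. norm (\<Prod>i\<in>T. Z i \<omega>) \<le> 1"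
    proof (intro AE_I2)
      fix \<omega>
      have "\<bar>Z i \<omega>\<bar> \<le> 1" for i using Z(2)[of i \<omega>] by auto
      thus "norm (\<Prod>i\<in>T. Z i \<omega>) \<le> 1" by (simp add: abs_prod prod_le_1)
    qed
    show "(\<lambda>\<omega>. \<Prod>i\<in>T. Z i \<omega>) \<in> borel_measurable M"
      using Z(1) that by (intro borel_measurable_prod) auto
  qed
  have ez: "exp (b i * Z i \<omega>) = c i * Z i \<omega> + 1" for i \<omega>
    using Z(2)[of i \<omega>] by (auto simp: c_def)
  have "exp (\<Sum>i\<in>I. b i * (Z i \<omega> - p)) =
      exp (- (\<Sum>i\<in>I. b i * p)) * (\<Sum>T\<in>Pow I. (\<Prod>i\<in>T. c i) * (\<Prod>i\<in>T. Z i \<omega>))" for \<omega>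
  proof -
    have "exp (\<Sum>i\<in>I. b i * (Z i \<omega> - p)) = exp (- (\<Sum>i\<in>I. b i * p)) * exp (\<Sum>i\<in>I. b i * Z i \<omega>)"
      by (simp add: right_diff_distrib sum_subtractf flip: exp_add)
    also have "exp (\<Sum>i\<in>I. b i * Z i \<omega>) = (\<Prod>i\<in>I. c i * Z i \<omega> + 1)"
      using I by (simp add: exp_sum ez)
    also have "\<dots> = (\<Sum>T\<in>Pow I. (\<Prod>i\<in>T. c i) * (\<Prod>i\<in>T. Z i \<omega>))"
      using I by (simp add: prod_add prod.distrib)
    finally show ?thesis .
  qed
  hence "expectation (\<lambda>\<omega>. exp (\<Sum>i\<in>I. b i * (Z i \<omega> - p))) =
      exp (- (\<Sum>i\<in>I. b i * p)) * (\<Sum>T\<in>Pow I. (\<Prod>i\<in>T. c i) * expectation (\<lambda>\<omega>. \<Prod>i\<in>T. Z i \<omega>))"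
    using int by (simp add: Bochner_Integration.integral_sum)
  also have "\<dots> \<le> exp (- (\<Sum>i\<in>I. b i * p)) * (\<Sum>T\<in>Pow I. (\<Prod>i\<in>T. c i) * p ^ card T)"
    using c dom by (intro mult_left_mono sum_mono prod_nonneg) auto
  also have "(\<Sum>T\<in>Pow I. (\<Prod>i\<in>T. c i) * p ^ card T) = (\<Prod>i\<in>I. 1 + p * c i)"
    using I by (subst add.commute) (simp add: prod_add prod.distrib mult.commute)
  also have "exp (- (\<Sum>i\<in>I. b i * p)) * \<dots> = (\<Prod>i\<in>I. exp (- b i * p) * (1 + p * c i))"
    using I by (simp add: prod.distrib exp_sum flip: sum_negf)
  also have "\<dots> \<le> (\<Prod>i\<in>I. exp ((b i)\<^sup>2 / 8))"
  proof (intro prod_mono conjI)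
    fix i assume i: "i \<in> I"
    have pos: "0 < 1 + p * c i" using p c[OF i] by (intro add_pos_nonneg) auto
    thus "0 \<le> exp (- b i * p) * (1 + p * c i)" by simp
    have "exp (- b i * p) * (1 + p * c i) = exp (- b i * p + ln (1 + p * c i))"
      using pos by (simp only: exp_add exp_ln)
    also have "\<dots> \<le> exp ((b i)\<^sup>2 / 8)"
      \<comment> \<open>The library bound is logarithmic: -b p + ln (1 + p (exp b - 1)) is at most
        b^2 / 8.\<close>
      using Hoeffdings_lemma_aux[of "b i" p] b[OF i] p by (simp add: c_def)
    finally show "exp (- b i * p) * (1 + p * c i) \<le> exp ((b i)\<^sup>2 / 8)" .
  qed
  also have "\<dots> = exp ((\<Sum>i\<in>I. (b i)\<^sup>2) / 8)"
    using I by (simp add: exp_sum sum_divide_distrib)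
  finally show ?thesis .
qed

end

text \<open>Isolates what the concentration argument uses of the process. Replacing \<open>Z\<close>
  and \<open>p\<close> by \<open>1 - Z\<close> and \<open>1 - p\<close> exchanges the two moment
  conditions, so upper and lower deviations are treated alike.\<close>

locale bernoulli_dominated = prob_space +
  fixes Z :: "'i \<Rightarrow> 'a \<Rightarrow> real" and p :: real
  assumes random_variable_Z [measurable]: "\<And>i. random_variable borel (Z i)"
    and Z_cases: "\<And>i \<omega>. Z i \<omega> \<in> {0, 1}"
    and p_nonneg: "0 \<le> p" and p_le_1: "p \<le> 1"
    and occupied: "\<And>T. finite T \<Longrightarrow> expectation (\<lambda>\<omega>. \<Prod>i\<in>T. Z i \<omega>) \<le> p ^ card T"
    and vacant: "\<And>T. finite T \<Longrightarrow> expectation (\<lambda>\<omega>. \<Prod>i\<in>T. 1 - Z i \<omega>) \<le> (1 - p) ^ card T"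
begin

lemma Z_diff_bounds: "\<bar>Z i \<omega> - p\<bar> \<le> 1"
  using Z_cases[of i \<omega>] p_nonneg p_le_1 by auto

lemma integrable_exp_linear: "integrable M (\<lambda>\<omega>. exp (\<Sum>i\<in>I. b i * (Z i \<omega> - p)))"
proof (rule integrable_const_bound)
  have "\<bar>\<Sum>i\<in>I. b i * (Z i \<omega> - p)\<bar> \<le> (\<Sum>i\<in>I. \<bar>b i\<bar>)" for \<omega>
  proof (rule order_trans[OF sum_abs sum_mono])
    show "\<bar>b i * (Z i \<omega> - p)\<bar> \<le> \<bar>b i\<bar>" for i
      using mult_left_mono[OF Z_diff_bounds, of "\<bar>b i\<bar>" i \<omega>] by (simp add: abs_mult)
  qed
  thus "AE \<omega> in M. norm (exp (\<Sum>i\<in>I. b i * (Z i \<omega> - p))) \<le> exp (\<Sum>i\<in>I. \<bar>b i\<bar>)"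
    by (intro AE_I2) (simp add: abs_le_iff)
qed measurable

lemma signed_exp_moment_le:
  assumes I: "finite I"
  shows "expectation (\<lambda>\<omega>. exp (\<Sum>i\<in>I. b i * (Z i \<omega> - p))) \<le> exp ((\<Sum>i\<in>I. (b i)\<^sup>2) / 2)"
proof -
  \<comment> \<open>The exponent is \<open>u / 2 + v / 2\<close>, where \<open>u\<close> and \<open>v\<close> have nonnegative weights on the occupied
    and on the vacant sites; hence the factors 2.\<close>
  define u where "u \<omega> = (\<Sum>i\<in>I. (2 * max 0 (b i)) * (Z i \<omega> - p))" for \<omega>
  define v where "v \<omega> = (\<Sum>i\<in>I. (2 * max 0 (- b i)) * ((1 - Z i \<omega>) - (1 - p)))" for \<omega>
  \<comment> \<open>The signs 1 and -1 serve \<open>u\<close> and \<open>v\<close>; squaring the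
    factor 2 turns 1 / 8 into 1 / 2.\<close>
  have sq: "(\<Sum>i\<in>I. (2 * max 0 (s * b i))\<^sup>2) / 8 \<le> (\<Sum>i\<in>I. (b i)\<^sup>2) / 2" if "s \<in> {1, -1}" for s
  proof -
    have "(\<Sum>i\<in>I. (2 * max 0 (s * b i))\<^sup>2) \<le> (\<Sum>i\<in>I. 4 * (b i)\<^sup>2)"
      using that by (intro sum_mono) (auto simp: max_def power_mult_distrib)
    thus ?thesis by (simp flip: sum_distrib_left)
  qed
  have u: "expectation (\<lambda>\<omega>. exp (u \<omega>)) \<le> exp ((\<Sum>i\<in>I. (b i)\<^sup>2) / 2)"
  proof -
    have "expectation (\<lambda>\<omega>. exp (u \<omega>)) \<le> exp ((\<Sum>i\<in>I. (2 * max 0 (b i))\<^sup>2) / 8)"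
      unfolding u_def
      by (rule centered_exp_moment_le[OF I p_nonneg p_le_1])
        (use Z_cases occupied finite_subset[OF _ I] in auto)
    thus ?thesis using sq[of 1] by (auto elim: order_trans)
  qed
  have v: "expectation (\<lambda>\<omega>. exp (v \<omega>)) \<le> exp ((\<Sum>i\<in>I. (b i)\<^sup>2) / 2)"
  proof -
    have "expectation (\<lambda>\<omega>. exp (v \<omega>)) \<le> exp ((\<Sum>i\<in>I. (2 * max 0 (- b i))\<^sup>2) / 8)"
      unfolding v_def
    proof (rule centered_exp_moment_le[OF I])
      show "1 - Z i \<omega> \<in> {0, 1}" for i \<omega> using Z_cases[of i \<omega>] by auto
    qed (use p_nonneg p_le_1 vacant finite_subset[OF _ I] in auto)
    thus ?thesis using sq[of "-1"] by (auto elim: order_trans)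
  qed
  have v': "v \<omega> = (\<Sum>i\<in>I. (- 2 * max 0 (- b i)) * (Z i \<omega> - p))" for \<omega>
    unfolding v_def by (intro sum.cong) (auto simp: algebra_simps)
  have int': "integrable M (\<lambda>\<omega>. exp (u \<omega>))" "integrable M (\<lambda>\<omega>. exp (v \<omega>))"
    unfolding u_def v' by (rule integrable_exp_linear)+
  \<comment> \<open>\<open>u\<close> and \<open>v\<close> are dependent; the inequality 2 x y <= x^2
    + y^2 replaces the product of exponentials by an average, whose expectation needs no
    independence.\<close>
  have "exp (\<Sum>i\<in>I. b i * (Z i \<omega> - p)) \<le> exp (u \<omega>) / 2 + exp (v \<omega>) / 2" for \<omega>
  proof -
    have "(\<Sum>i\<in>I. b i * (Z i \<omega> - p)) = u \<omega> / 2 + v \<omega> / 2"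
      unfolding u_def v' sum_divide_distrib sum.distrib[symmetric]
      by (intro sum.cong) (auto simp: max_def field_simps)
    moreover have "2 * (exp (u \<omega> / 2) * exp (v \<omega> / 2)) \<le> (exp (u \<omega> / 2))\<^sup>2 + (exp (v \<omega> / 2))\<^sup>2"
      using sum_squares_bound[of "exp (u \<omega> / 2)" "exp (v \<omega> / 2)"] by simp
    ultimately show ?thesis by (simp add: exp_add flip: exp_double)
  qed
  hence "expectation (\<lambda>\<omega>. exp (\<Sum>i\<in>I. b i * (Z i \<omega> - p))) \<le>
      expectation (\<lambda>\<omega>. exp (u \<omega>) / 2 + exp (v \<omega>) / 2)"
    using integrable_exp_linear int' by (intro integral_mono) auto
  also have "\<dots> \<le> exp ((\<Sum>i\<in>I. (b i)\<^sup>2) / 2)"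
    using u v int' by simp
  finally show ?thesis .
qed

text \<open>Chernoff's method: Markov's inequality for the exponential, combined with the
  sub-Gaussian moment bound.\<close>

lemma linear_tail:
  assumes I: "finite I" "I \<noteq> {}" and b: "\<And>i. i \<in> I \<Longrightarrow> \<bar>b i\<bar> \<le> 1" and v: "0 \<le> v"
  shows "prob {\<omega> \<in> space M. (\<Sum>i\<in>I. b i * (Z i \<omega> - p)) \<ge> v} \<le> exp (- v\<^sup>2 / (2 * card I))"
\<comment> \<open>For \<open>v = 0\<close> the bound is 1; otherwise the rate \<open>l\<close> below
  is positive, as the passage to exponentials requires.\<close>
proof (cases "v = 0")
  case False
  hence v: "0 < v" using v by simp
  define n where "n = real (card I)"
  have n: "0 < n" using I by (simp add: n_def card_gt_0_iff)
  \<comment> \<open>Minimises l^2 n / 2 - l v, with minimum -v^2 / (2 n).\<close>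
  define l where "l = v / n"
  have l: "0 < l" using v n by (simp add: l_def)
  have sum: "(\<Sum>i\<in>I. (l * b i) * (Z i \<omega> - p)) = l * (\<Sum>i\<in>I. b i * (Z i \<omega> - p))" for \<omega>
    by (simp add: sum_distrib_left mult_ac)
  have "prob {\<omega> \<in> space M. (\<Sum>i\<in>I. b i * (Z i \<omega> - p)) \<ge> v} =
      prob {\<omega> \<in> space M. exp (\<Sum>i\<in>I. (l * b i) * (Z i \<omega> - p)) \<ge> exp (l * v)}"
    unfolding sum using l by simp
  also have "\<dots> \<le> expectation (\<lambda>\<omega>. exp (\<Sum>i\<in>I. (l * b i) * (Z i \<omega> - p))) / exp (l * v)"
    by (rule integral_Markov_inequality_measure[where A = "space M"])
      (auto intro: integrable_exp_linear)
  also have "\<dots> \<le> exp ((\<Sum>i\<in>I. (l * b i)\<^sup>2) / 2) / exp (l * v)"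
    by (intro divide_right_mono signed_exp_moment_le I) auto
  also have "\<dots> \<le> exp (l\<^sup>2 * n / 2) / exp (l * v)"
  proof -
    have "(\<Sum>i\<in>I. (l * b i)\<^sup>2) \<le> (\<Sum>i\<in>I. l\<^sup>2)"
      using b by (intro sum_mono) (auto simp: power_mult_distrib abs_square_le_1 intro!: mult_left_le)
    thus ?thesis by (simp add: divide_right_mono n_def mult_ac)
  qed
  also have "\<dots> = exp (- v\<^sup>2 / (2 * n))"
    using n by (simp add: l_def field_simps power2_eq_square flip: exp_diff)
  finally show ?thesis by (simp add: n_def)
qed simp

end

section \<open>Exponential sums: Lipschitz bound and size of the frequencies\<close>

lemma exp_sum_cis:
  "exp_sum a P N t = (\<Sum>n<N. of_real (a n) * cis (2 * pi * of_int (poly P (int n)) * t))"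
  unfolding exp_sum_def cis_conv_exp by (simp add: mult_ac)

lemma Re_exp_sum: "Re (exp_sum a P N t) = (\<Sum>n<N. a n * cos (2 * pi * of_int (poly P (int n)) * t))"
  and Im_exp_sum: "Im (exp_sum a P N t) = (\<Sum>n<N. a n * sin (2 * pi * of_int (poly P (int n)) * t))"
  by (simp_all add: exp_sum_cis)

text \<open>A chord is no longer than its arc: after factoring out the unimodular
  \<open>cis y\<close>, this is the order-zero Taylor estimate of \<open>cis\<close> at 0.\<close>

lemma dist_cis_le: "cmod (cis x - cis y) \<le> \<bar>x - y\<bar>"
proof -
  have "cis x - cis y = cis y * (cis (x - y) - 1)"
    by (simp add: algebra_simps cis_mult)
  hence "cmod (cis x - cis y) = cmod (cis (x - y) - 1)" by (simp add: norm_mult)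
  also have "\<dots> \<le> \<bar>x - y\<bar>"
    using iexp_approx1[of "x - y" 0] by (simp add: cis_conv_exp)
  finally show ?thesis .
qed

text \<open>The chord bound is applied term by term. The frequency bound \<open>D\<close> stays a
  parameter, so that the degree of \<open>P\<close> enters only with the final choice of
  constants.\<close>

lemma exp_sum_lipschitz:
  assumes a: "\<And>n. n < N \<Longrightarrow> \<bar>a n\<bar> \<le> 1" and D: "\<And>n. n < N \<Longrightarrow> \<bar>real_of_int (poly P (int n))\<bar> \<le> D"
  shows "cmod (exp_sum a P N t - exp_sum a P N s) \<le> 2 * pi * D * real N * \<bar>t - s\<bar>"
proof -
  have "exp_sum a P N t - exp_sum a P N s = (\<Sum>n<N. of_real (a n) *
      (cis (2 * pi * of_int (poly P (int n)) * t) - cis (2 * pi * of_int (poly P (int n)) * s)))"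
    by (simp add: exp_sum_cis sum_subtractf right_diff_distrib)
  also have "cmod \<dots> \<le> (\<Sum>n<N. 2 * pi * D * \<bar>t - s\<bar>)"
  proof (rule sum_norm_le)
    fix n assume "n \<in> {..<N}"
    hence n: "n < N" by simp
    let ?q = "real_of_int (poly P (int n))"
    have "cmod (of_real (a n) * (cis (2 * pi * ?q * t) - cis (2 * pi * ?q * s)))
        \<le> 1 * \<bar>2 * pi * ?q * t - 2 * pi * ?q * s\<bar>"
      unfolding norm_mult using a[OF n] by (intro mult_mono dist_cis_le) auto
    also have "\<bar>2 * pi * ?q * t - 2 * pi * ?q * s\<bar> = 2 * pi * \<bar>?q\<bar> * \<bar>t - s\<bar>"
      by (simp add: abs_mult flip: right_diff_distrib)
    also have "1 * \<dots> \<le> 2 * pi * D * \<bar>t - s\<bar>"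
      using D[OF n] by (simp add: mult_left_mono mult_right_mono)
    finally show "cmod (of_real (a n) * (cis (2 * pi * ?q * t) - cis (2 * pi * ?q * s)))
        \<le> 2 * pi * D * \<bar>t - s\<bar>" .
  qed
  finally show ?thesis by (simp add: mult_ac)
qed

text \<open>The extra power of \<open>N\<close> absorbs the sum \<open>C\<close> of the absolute
  values of the coefficients.\<close>

lemma poly_eventually_le_power:
  fixes P :: "int poly"
  shows "\<forall>\<^sub>F N in sequentially. \<forall>n<N. \<bar>poly P (int n)\<bar> \<le> int N ^ (degree P + 1)"
proof -
  define C where "C = (\<Sum>i\<le>degree P. \<bar>coeff P i\<bar>)"
  show ?thesis
    using eventually_ge_at_top[of "max 1 (nat C)"]
  proof eventually_elim
    case (elim N)
    have "\<bar>poly P (int n)\<bar> \<le> int N ^ (degree P + 1)" if "n < N" for n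
    proof -
      have "\<bar>poly P (int n)\<bar> \<le> (\<Sum>i\<le>degree P. \<bar>coeff P i * int n ^ i\<bar>)"
        unfolding poly_altdef by (rule sum_abs)
      also have "\<dots> \<le> (\<Sum>i\<le>degree P. \<bar>coeff P i\<bar> * int N ^ degree P)"
      proof (rule sum_mono)
        fix i assume "i \<in> {..degree P}"
        hence "int n ^ i \<le> int N ^ degree P"
          using that by (intro order_trans[OF power_mono[of "int n" "int N"] power_increasing]) auto
        thus "\<bar>coeff P i * int n ^ i\<bar> \<le> \<bar>coeff P i\<bar> * int N ^ degree P"
          by (simp add: abs_mult mult_left_mono)
      qed
      also have "\<dots> = C * int N ^ degree P" by (simp add: C_def sum_distrib_right)
      also have "\<dots> \<le> int N * int N ^ degree P" using elim by (intro mult_right_mono) auto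
      finally show ?thesis by simp
    qed
    thus ?case by blast
  qed
qed

section \<open>Tail bounds for the maximum and the almost sure bound\<close>

locale bernoulli_dominated_sequence = bernoulli_dominated M Z p
  for M :: "'a measure" and Z :: "nat \<Rightarrow> 'a \<Rightarrow> real" and p :: real
begin

lemma borel_measurable_exp_sum [measurable]:
  "(\<lambda>\<omega>. exp_sum (\<lambda>n. Z n \<omega> - p) P N t) \<in> borel_measurable M"
  unfolding exp_sum_def by measurable

lemma borel_measurable_max_exp_sum [measurable]:
  "(\<lambda>\<omega>. max_exp_sum (\<lambda>n. Z n \<omega> - p) P N) \<in> borel_measurable M"
  by (rule max_exp_sum_measurable) measurable

text \<open>A modulus of at least \<open>u\<close> forces one of Re, -Re, Im, -Im to reach
  \<open>u / sqrt 2\<close>. This accounts for the factor 4 and, through \<open>linear_tail\<close>,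
  for the 4 in the exponent.\<close>

lemma exp_sum_tail:
  assumes N: "0 < N" and u: "0 \<le> u"
  shows "prob {\<omega> \<in> space M. cmod (exp_sum (\<lambda>n. Z n \<omega> - p) P N t) \<ge> u} \<le>
    4 * exp (- u\<^sup>2 / (4 * real N))"
proof -
  define v where "v = u / sqrt 2"
  define E where "E b = {\<omega> \<in> space M. (\<Sum>n<N. b n * (Z n \<omega> - p)) \<ge> v}" for b :: "nat \<Rightarrow> real"
  define c where "c n = cos (2 * pi * of_int (poly P (int n)) * t)" for n
  define s where "s n = sin (2 * pi * of_int (poly P (int n)) * t)" for n
  have [measurable]: "E b \<in> events" for b unfolding E_def by measurable
  have E: "prob (E b) \<le> exp (- u\<^sup>2 / (4 * real N))" if "\<And>n. \<bar>b n\<bar> \<le> 1" for b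
  proof -
    have "prob (E b) \<le> exp (- v\<^sup>2 / (2 * card {..<N}))"
      unfolding E_def by (rule linear_tail) (use that N u in \<open>auto simp: v_def\<close>)
    thus ?thesis by (simp add: v_def power_divide)
  qed
  have "\<omega> \<in> (E c \<union> E (\<lambda>n. - c n)) \<union> (E s \<union> E (\<lambda>n. - s n))"
    if "\<omega> \<in> space M" "cmod (exp_sum (\<lambda>n. Z n \<omega> - p) P N t) \<ge> u" for \<omega>
  proof (rule ccontr)
    let ?S = "exp_sum (\<lambda>n. Z n \<omega> - p) P N t"
    have Re: "Re ?S = (\<Sum>n<N. c n * (Z n \<omega> - p))" and Im: "Im ?S = (\<Sum>n<N. s n * (Z n \<omega> - p))"
      by (simp_all add: Re_exp_sum Im_exp_sum c_def s_def mult.commute)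
    assume "\<not> ?thesis"
    hence "\<bar>Re ?S\<bar> < v" "\<bar>Im ?S\<bar> < v"
      using that(1) by (auto simp: E_def Re Im sum_negf abs_less_iff)
    hence "\<bar>Re ?S\<bar>\<^sup>2 < v\<^sup>2" "\<bar>Im ?S\<bar>\<^sup>2 < v\<^sup>2"
      using power_strict_mono[OF _ abs_ge_zero zero_less_numeral] by blast+
    hence "(cmod ?S)\<^sup>2 < u\<^sup>2" by (simp add: cmod_power2 v_def power_divide)
    hence "cmod ?S < u" by (rule power_less_imp_less_base) (use u in auto)
    thus False using that(2) by simp
  qed
  hence "prob {\<omega> \<in> space M. cmod (exp_sum (\<lambda>n. Z n \<omega> - p) P N t) \<ge> u} \<le>
      prob ((E c \<union> E (\<lambda>n. - c n)) \<union> (E s \<union> E (\<lambda>n. - s n)))"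
    by (intro finite_measure_mono) auto
  also have "\<dots> \<le> prob (E c \<union> E (\<lambda>n. - c n)) + prob (E s \<union> E (\<lambda>n. - s n))"
    by (rule measure_Un_le) auto
  also have "\<dots> \<le> (prob (E c) + prob (E (\<lambda>n. - c n))) + (prob (E s) + prob (E (\<lambda>n. - s n)))"
    by (intro add_mono measure_Un_le) auto
  also have "\<dots> \<le> 4 * exp (- u\<^sup>2 / (4 * real N))"
    using E[of c] E[of "\<lambda>n. - c n"] E[of s] E[of "\<lambda>n. - s n"] by (simp add: c_def s_def)
  finally show ?thesis .
qed

text \<open>The point where the maximum is attained has a grid point within 1 / J, where by the
  Lipschitz bound the modulus is still at least \<open>u\<close>. A union bound over the grid
  finishes.\<close>

lemma max_exp_sum_tail_grid:
  assumes N: "0 < N" and J: "0 < J" and u: "0 \<le> u"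
    and D: "\<And>n. n < N \<Longrightarrow> \<bar>real_of_int (poly P (int n))\<bar> \<le> D"
  shows "prob {\<omega> \<in> space M. max_exp_sum (\<lambda>n. Z n \<omega> - p) P N \<ge> u + 2 * pi * D * real N / real J} \<le>
    4 * (real J + 1) * exp (- u\<^sup>2 / (4 * real N))"
proof -
  define G where "G j = {\<omega> \<in> space M. cmod (exp_sum (\<lambda>n. Z n \<omega> - p) P N (real j / real J)) \<ge> u}" for j
  have G_ev [measurable]: "G j \<in> events" for j unfolding G_def by measurable
  have D0: "0 \<le> D" using D[of 0] N by simp
  have "\<exists>j\<le>J. \<omega> \<in> G j"
    if \<omega>: "\<omega> \<in> space M" and ge: "max_exp_sum (\<lambda>n. Z n \<omega> - p) P N \<ge> u + 2 * pi * D * real N / real J" for \<omega>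
  proof -
    let ?S = "exp_sum (\<lambda>n. Z n \<omega> - p) P N"
    obtain t where t: "t \<in> {0..1}" "max_exp_sum (\<lambda>n. Z n \<omega> - p) P N = cmod (?S t)"
      using max_exp_sum_attained by blast
    \<comment> \<open>The nearest grid point not to the right of \<open>t\<close>. Since
      \<open>t = 1\<close> gives \<open>j = J\<close>, the grid has J + 1 points.\<close>
    define j where "j = nat \<lfloor>t * real J\<rfloor>"
    have j: "real j \<le> t * real J" "t * real J \<le> real j + 1"
      using t by (simp_all add: j_def)
    have "real j \<le> real J" using j(1) t(1) mult_right_mono[of t 1 "real J"] by auto
    hence jJ: "j \<le> J" by simp
    have "\<bar>t - real j / real J\<bar> \<le> 1 / real J"
    proof -
      have "\<bar>t * real J - real j\<bar> \<le> 1" using j by linarith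
      hence "\<bar>(t * real J - real j) / real J\<bar> \<le> 1 / real J" by (simp add: divide_right_mono)
      thus ?thesis using J by (simp add: diff_divide_distrib)
    qed
    hence "2 * pi * D * real N * \<bar>t - real j / real J\<bar> \<le> 2 * pi * D * real N * (1 / real J)"
      using D0 by (intro mult_left_mono) auto
    moreover have "cmod (?S t - ?S (real j / real J)) \<le> 2 * pi * D * real N * \<bar>t - real j / real J\<bar>"
      by (rule exp_sum_lipschitz) (use Z_diff_bounds D in auto)
    moreover have "cmod (?S t) \<le> cmod (?S (real j / real J)) + cmod (?S t - ?S (real j / real J))"
      by (metis add.commute norm_triangle_sub)
    ultimately have "u \<le> cmod (?S (real j / real J))"
      using ge t(2) by simp
    with jJ \<omega> show ?thesis by (auto simp: G_def)
  qed
  hence "prob {\<omega> \<in> space M. max_exp_sum (\<lambda>n. Z n \<omega> - p) P N \<ge> u + 2 * pi * D * real N / real J} \<le>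
      prob (\<Union>j\<in>{..J}. G j)"
    by (intro finite_measure_mono) auto
  also have "\<dots> \<le> (\<Sum>j\<in>{..J}. prob (G j))"
    using G_ev by (intro finite_measure_subadditive_finite) auto
  also have "\<dots> \<le> (\<Sum>j\<in>{..J}. 4 * exp (- u\<^sup>2 / (4 * real N)))"
    unfolding G_def by (intro sum_mono exp_sum_tail N u)
  finally show ?thesis by (simp add: algebra_simps)
qed

text \<open>The threshold splits into 50 L for the grid values and 50 L for the discretisation
  error. The exponent then yields N to the power -625 d, which outweighs the size of the
  grid.\<close>

lemma max_exp_sum_tail:
  fixes P :: "int poly"
  assumes d: "degree P = d" "d \<ge> 1"
  shows "\<forall>\<^sub>F N in sequentially.
    prob {\<omega> \<in> space M.
      max_exp_sum (\<lambda>n. Z n \<omega> - p) P N \<ge> 100 * sqrt (real d * real N * ln (real N))}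
    \<le> 1 / (real N)\<^sup>2"
  \<comment> \<open>Since e <= 3, the condition N >= 3 ensures ln N >= 1 and hence L >= 1.\<close>
  using poly_eventually_le_power[of P] eventually_ge_at_top[of 3]
proof eventually_elim
  case (elim N)
  have N: "3 \<le> N" by fact
  define L where "L = sqrt (real d * real N * ln (real N))"
  have ln: "1 \<le> ln (real N)"
  proof -
    have "exp 1 \<le> real N" using exp_le N by linarith
    thus ?thesis using N by (simp add: ln_ge_iff)
  qed
  have L2: "L\<^sup>2 = real d * real N * ln (real N)" using ln by (simp add: L_def)
  have "1 * 1 * 1 \<le> real d * real N * ln (real N)"
    using d N ln by (intro mult_mono) auto
  hence L: "1 \<le> L" by (simp add: L_def)
  have D: "\<bar>real_of_int (poly P (int n))\<bar> \<le> real N ^ (d + 1)" if "n < N" for n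
  proof -
    have "\<bar>poly P (int n)\<bar> \<le> int N ^ (d + 1)" using elim(1) that d by blast
    hence "real_of_int \<bar>poly P (int n)\<bar> \<le> real_of_int (int N ^ (d + 1))" by (simp only: of_int_le_iff)
    thus ?thesis by simp
  qed
  \<comment> \<open>This mesh cancels the factor \<open>N ^ (d + 1) * N\<close> of the Lipschitz
    constant exactly, leaving an error of 2 pi.\<close>
  define J where "J = N ^ (d + 2)"
  have J: "0 < J" using N by (simp add: J_def)
  have "2 * pi * real N ^ (d + 1) * real N / real J = 2 * pi"
    using N by (simp add: J_def)
  also have "\<dots> \<le> 50 * L" using L pi_less_4 by linarith
  finally have "50 * L + 2 * pi * real N ^ (d + 1) * real N / real J \<le> 100 * L" by simp
  hence "prob {\<omega> \<in> space M. max_exp_sum (\<lambda>n. Z n \<omega> - p) P N \<ge> 100 * L} \<le>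
      prob {\<omega> \<in> space M. max_exp_sum (\<lambda>n. Z n \<omega> - p) P N \<ge>
        50 * L + 2 * pi * real N ^ (d + 1) * real N / real J}"
    by (intro finite_measure_mono) auto
  also have "\<dots> \<le> 4 * (real J + 1) * exp (- (50 * L)\<^sup>2 / (4 * real N))"
    by (rule max_exp_sum_tail_grid) (use N J L D in auto)
  \<comment> \<open>Here 50^2 / 4 = 625, and the factor N of L^2 cancels.\<close>
  also have "exp (- (50 * L)\<^sup>2 / (4 * real N)) = exp (- (real (625 * d) * ln (real N)))"
    using N by (simp add: power_mult_distrib L2)
  also have "\<dots> = 1 / real N ^ (625 * d)"
    using N by (simp only: exp_minus exp_of_nat_mult exp_ln inverse_eq_divide)
  also have "4 * (real J + 1) * \<dots> \<le> 1 / (real N)\<^sup>2"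
  proof -
    \<comment> \<open>From J >= 1 and 8 <= N^3 the left side is at most N^(d + 7), and d + 7 <= 625
      d because d >= 1.\<close>
    have "4 * (real J + 1) * (real N)\<^sup>2 \<le> 8 * real J * (real N)\<^sup>2"
      using J by (intro mult_right_mono) auto
    also have "\<dots> \<le> real N ^ 3 * real J * (real N)\<^sup>2"
      using power_mono[of 2 "real N" 3] N by (intro mult_right_mono) auto
    also have "\<dots> = real N ^ (3 + (d + 2) + 2)" by (simp only: J_def of_nat_power of_nat_mult power_add)
    also have "\<dots> \<le> real N ^ (625 * d)" using N d by (intro power_increasing) auto
    finally show ?thesis using N by (simp add: field_simps)
  qed
  finally show ?case by (simp add: L_def)
qed

text \<open>The tails 1 / N^2 are summable, so by Borel-Cantelli the constant 100 works from a
  random \<open>N0\<close> on; the finitely many earlier \<open>N\<close> are absorbed into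
  \<open>C\<close>.\<close>

lemma max_exp_sum_AE_bounded:
  fixes P :: "int poly"
  assumes d: "degree P = d" "d \<ge> 1"
  shows "AE \<omega> in M. \<exists>C>0. \<forall>N\<ge>2.
    max_exp_sum (\<lambda>n. Z n \<omega> - p) P N \<le> C * sqrt (real d * real N * ln (real N))"
proof -
  define L where "L N = sqrt (real d * real N * ln (real N))" for N
  define A where "A N = {\<omega> \<in> space M. max_exp_sum (\<lambda>n. Z n \<omega> - p) P N \<ge> 100 * L N}" for N
  have L: "0 < L N" if "N \<ge> 2" for N using that d by (simp add: L_def)
  have nonneg: "0 \<le> max_exp_sum a P N" for a N
    using max_exp_sum_attained[of a P N] by (metis norm_ge_zero)
  have "summable (\<lambda>N. prob (A N))"
  proof (rule summable_comparison_test_ev)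
    show "\<forall>\<^sub>F N in sequentially. norm (prob (A N)) \<le> inverse (real N ^ 2)"
      using max_exp_sum_tail[OF d] by (simp add: A_def L_def inverse_eq_divide)
    show "summable (\<lambda>N. inverse (real N ^ 2))" by (rule inverse_power_summable) simp
  qed
  moreover have "A N \<in> events" for N unfolding A_def by measurable
  ultimately have "AE \<omega> in M. \<forall>\<^sub>F N in sequentially. \<omega> \<in> space M - A N"
    by (intro borel_cantelli_AE1) (auto simp: emeasure_eq_measure)
  thus ?thesis
  proof eventually_elim
    case (elim \<omega>)
    let ?m = "max_exp_sum (\<lambda>n. Z n \<omega> - p) P"
    obtain N0 where N0: "\<And>N. N \<ge> N0 \<Longrightarrow> ?m N < 100 * L N"
      using elim by (auto simp: eventually_sequentially A_def not_le)
    \<comment> \<open>The sum dominates each ratio below \<open>N0\<close>; it starts at 2 because L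
      N > 0 holds from there on. The summand 100 serves N >= N0 and keeps \<open>C\<close>
      positive.\<close>
    define C where "C = 100 + (\<Sum>N\<in>{2..<N0}. ?m N / L N)"
    have sum_nonneg: "0 \<le> (\<Sum>N\<in>{2..<N0}. ?m N / L N)"
      using nonneg L by (intro sum_nonneg divide_nonneg_pos) auto
    have "?m N \<le> C * L N" if N: "N \<ge> 2" for N
    proof (cases "N < N0")
      case True
      have "?m N / L N \<le> (\<Sum>N\<in>{2..<N0}. ?m N / L N)"
        using True N nonneg L by (intro member_le_sum divide_nonneg_pos) auto
      hence "?m N / L N \<le> C" by (simp add: C_def)
      thus ?thesis using L[OF N] by (simp add: pos_divide_le_eq)
    next
      case False
      have "?m N \<le> 100 * L N" using N0[of N] False by simp
      also have "\<dots> \<le> C * L N"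
        using sum_nonneg L[OF N] by (intro mult_right_mono) (auto simp: C_def)
      finally show ?thesis .
    qed
    moreover have "C > 0" using sum_nonneg by (simp add: C_def)
    ultimately show ?case unfolding L_def by blast
  qed
qed

end

section \<open>The determinantal process\<close>

text \<open>Both dominations are \<open>perm_det_fourier_kernel_le\<close>, for \<open>f\<close> at
  occupied and for \<open>1 - f\<close> at vacant sites. Injectivity of \<open>int\<close> carries
  index sets of naturals to sets of sites of equal size.\<close>

lemma determinantal_bernoulli_dominated:
  assumes f: "f \<in> borel_measurable borel" "\<And>t. f t \<in> {0..1}"
    and dpp: "determinantal_point_process M (fourier_kernel f) X"
  shows "bernoulli_dominated_sequence M (\<lambda>n. occupation X (int n)) (circle_integral f)"
proof -
  interpret prob_space M using dpp by (simp add: determinantal_point_process_def)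
  let ?g = "\<lambda>t. 1 - f t"
  have g: "?g \<in> borel_measurable borel" "\<And>t. ?g t \<in> {0..1}" using f by auto
  have nonneg: "0 \<le> circle_integral h" if "\<And>t. h t \<in> {0..1}" for h :: "real \<Rightarrow> real"
    unfolding circle_integral_altdef using that by (intro Bochner_Integration.integral_nonneg) auto
  have img: "finite (int ` T)" "card (int ` T) = card T" if "finite T" for T
    using that by (auto simp: card_image)
  have vacant_kernel: "(\<lambda>i j. of_bool (i = j) - fourier_kernel f i j) = fourier_kernel ?g"
    by (simp add: fun_eq_iff fourier_kernel_def fourier_coeff_one_minus[OF f])
  show ?thesis
  proof unfold_locales
    show "random_variable borel (occupation X (int n))" for n
      using dpp by (simp add: determinantal_point_process_def)
    show "occupation X (int n) \<omega> \<in> {0, 1}" for n \<omega> by (simp add: occupation_def)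
    show "0 \<le> circle_integral f" using f(2) by (rule nonneg)
    show "circle_integral f \<le> 1"
      using nonneg[of ?g, OF g(2)] circle_integral_one_minus[OF f] by simp
    show "expectation (\<lambda>\<omega>. \<Prod>n\<in>T. occupation X (int n) \<omega>) \<le> circle_integral f ^ card T"
      if T: "finite T" for T
    proof -
      have "expectation (\<lambda>\<omega>. \<Prod>n\<in>T. occupation X (int n) \<omega>) = Re (perm_det (int ` T) (fourier_kernel f))"
        unfolding determinantal_occupied[OF dpp img(1)[OF T], symmetric] by (simp add: prod.reindex)
      thus ?thesis using perm_det_fourier_kernel_le[OF f img(1)[OF T]] img(2)[OF T] by simp
    qed
    show "expectation (\<lambda>\<omega>. \<Prod>n\<in>T. 1 - occupation X (int n) \<omega>) \<le> (1 - circle_integral f) ^ card T"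
      if T: "finite T" for T
    proof -
      have "expectation (\<lambda>\<omega>. \<Prod>n\<in>T. 1 - occupation X (int n) \<omega>) = Re (perm_det (int ` T) (fourier_kernel ?g))"
        unfolding vacant_kernel[symmetric] determinantal_vacant[OF dpp img(1)[OF T], symmetric]
        by (simp add: prod.reindex)
      thus ?thesis
        using perm_det_fourier_kernel_le[OF g img(1)[OF T]] img(2)[OF T] circle_integral_one_minus[OF f]
        by simp
    qed
  qed
qed

theorem theorem3p3:
  fixes f :: "real \<Rightarrow> real" and \<sigma> :: real
    and M :: "'w measure" and X :: "'w \<Rightarrow> int set" and \<xi> :: "int \<Rightarrow> 'w \<Rightarrow> real"
    and P :: "int poly" and d :: nat
  assumes "circle_fun f" and "f \<in> borel_measurable borel" and "\<And>t. f t \<in> {0..1}"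
    and "\<sigma> = circle_integral f" and "0 < \<sigma>" and "\<sigma> < 1"
    and "prob_space M" and "determinantal_point_process M (fourier_kernel f) X"
    and "\<xi> = occupation X"
    and "degree P = d" and "d \<ge> 1" and "\<And>n::nat. poly P (int n) \<ge> 0"
  shows "(\<forall>\<^sub>F N in sequentially.
            measure M {\<omega> \<in> space M.
              max_exp_sum (\<lambda>n. \<xi> (int n) \<omega> - \<sigma>) P N \<ge> 100 * sqrt (real d * real N * ln (real N))}
            \<le> 1 / (real N)\<^sup>2) \<and>
         (AE \<omega> in M. \<exists>C>0. \<forall>N\<ge>2.
            max_exp_sum (\<lambda>n. \<xi> (int n) \<omega> - \<sigma>) P N \<le> C * sqrt (real d * real N * ln (real N)))"
proof -
  interpret bernoulli_dominated_sequence M "\<lambda>n. \<xi> (int n)" \<sigma>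
    unfolding \<open>\<xi> = occupation X\<close> \<open>\<sigma> = circle_integral f\<close>
    by (rule determinantal_bernoulli_dominated) fact+
  show ?thesis
    using max_exp_sum_tail[of P d] max_exp_sum_AE_bounded[of P d] \<open>degree P = d\<close> \<open>d \<ge> 1\<close> by blast
qed

end
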